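(* Let $\Theta=\{\theta_1<\dots<\theta_K\}\subset\mathbb{R}_+$. For any $\mu\in\Delta(\Theta)$ with full support and any $w\in\overline{\mathcal{R}}$ (strictly redistributive), every $(\mathrm{P}^\star_{w,\mu})$-optimal segmentation is weakly monotone.
   Context: Setting. $\Theta=\{\theta_1<\dots<\theta_K\}\subset\mathbb{R}_+$ is a finite set (buyer types) and $P=\Theta$ (prices). $\Delta(X)$ is the set of probability distributions on a finite set $X$. The market $\mu\in\Delta(\Theta)$ satisfies $\mu(\theta)>0$ for all $\theta\in\Theta$. Segmentations. $\Sigma(\mu)$ is the set of $\sigma\in\Delta(\Theta\times P)$ such that $\sum_{p\in P}\sigma(\theta,p)=\mu(\theta)$ for all $\theta\in\Theta$ and (obedience) for all $p,q\in P$, $p\sum_{\theta\ge p}\sigma(\theta,p)\ge q\sum_{\theta\ge q}\sigma(\theta,p)$. Let $\Omega=\{(\theta,p)\in\Theta\times P:\theta\ge p\}$ and $\Sigma^\star(\mu)=\{\sigma\in\Sigma(\mu):\operatorname{supp}(\sigma)\subseteq\Omega\}$. Let $\sigma_P(p)=\sum_{\theta}\sigma(\theta,p)$, and for $p\in\operatorname{supp}(\sigma_P)$ let $\sigma(\cdot\,|\,p)=\sigma(\cdot,p)/\sigma_P(p)$. Strictly redistributive welfare functions. $\overline{\mathcal{R}}$ is the set of $w:\Theta\times P\to\mathbb{R}$ such that: $w(\theta,p)=0$ if $\theta<p$ and $w(\theta,p)\ge0$ if $\theta\ge p$; for each $k$, $p\mapsto w(\theta_k,p)$ is strictly decreasing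 on $\{\theta_1,\dots,\theta_k\}$; and for all $\theta,\theta'\in\Theta$ and $p,p'\in P$ with $\theta'>\theta\ge p'>p$, $w(\theta,p)-w(\theta,p')> w(\theta',p)-w(\theta',p')$. Optimality. $\sigma$ is $(\mathrm{P}^\star_{w,\mu})$-optimal if it maximizes $\sum_{(\theta,p)\in\Theta\times P}w(\theta,p)\sigma(\theta,p)$ over $\sigma\in\Sigma^\star(\mu)$. Weak monotonicity. $\sigma\in\Sigma^\star(\mu)$ is weakly monotone if for any $p,p'\in\operatorname{supp}(\sigma_P)$ with $p<p'$, $\max\operatorname{supp}(\sigma(\cdot\,|\,p))\le\max\operatorname{supp}(\sigma(\cdot\,|\,p'))$. *)

theory Defs
  imports "HOL-Probability.Probability"
begin

text \<open>
  Throughout, \<open>\<Theta>\<close> is both the set of buyer types and the set of prices. In a pair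
  \<open>(\<theta>, p)\<close> the first component is the type and the second one the price.
\<close>

definition Delta :: "'a set \<Rightarrow> 'a pmf set" where
  "Delta X = {\<pi>. set_pmf \<pi> \<subseteq> X}"

definition obedient :: "real set \<Rightarrow> (real \<times> real) pmf \<Rightarrow> bool" where
  "obedient \<Theta> \<sigma> \<longleftrightarrow>
     (\<forall>p\<in>\<Theta>. \<forall>q\<in>\<Theta>.
        p * (\<Sum>\<theta>\<in>{\<theta>\<in>\<Theta>. \<theta> \<ge> p}. pmf \<sigma> (\<theta>, p)) \<ge>
        q * (\<Sum>\<theta>\<in>{\<theta>\<in>\<Theta>. \<theta> \<ge> q}. pmf \<sigma> (\<theta>, p)))"

definition segmentations :: "real set \<Rightarrow> real pmf \<Rightarrow> (real \<times> real) pmf set" where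
  "segmentations \<Theta> \<mu> =
     {\<sigma>\<in>Delta (\<Theta> \<times> \<Theta>).
        (\<forall>\<theta>\<in>\<Theta>. (\<Sum>p\<in>\<Theta>. pmf \<sigma> (\<theta>, p)) = pmf \<mu> \<theta>) \<and> obedient \<Theta> \<sigma>}"

definition Omega :: "real set \<Rightarrow> (real \<times> real) set" where
  "Omega \<Theta> = {(\<theta>, p) \<in> \<Theta> \<times> \<Theta>. \<theta> \<ge> p}"

definition segmentations_star :: "real set \<Rightarrow> real pmf \<Rightarrow> (real \<times> real) pmf set" where
  "segmentations_star \<Theta> \<mu> = {\<sigma>\<in>segmentations \<Theta> \<mu>. set_pmf \<sigma> \<subseteq> Omega \<Theta>}"

definition price_marginal :: "(real \<times> real) pmf \<Rightarrow> real pmf" where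
  "price_marginal \<sigma> = map_pmf snd \<sigma>"

text \<open>
  The distribution of types conditional on the price \<open>p\<close>; it is only meaningful if \<open>p\<close> is in
  the support of the price marginal.
\<close>

definition type_cond :: "(real \<times> real) pmf \<Rightarrow> real \<Rightarrow> real pmf" where
  "type_cond \<sigma> p = map_pmf fst (cond_pmf \<sigma> (UNIV \<times> {p}))"

lemma pmf_price_marginal:
  assumes "finite \<Theta>" and "\<sigma> \<in> Delta (\<Theta> \<times> \<Theta>)"
  shows "pmf (price_marginal \<sigma>) p = (\<Sum>\<theta>\<in>\<Theta>. pmf \<sigma> (\<theta>, p))"
proof -
  have "pmf (price_marginal \<sigma>) p = measure \<sigma> (snd -` {p})"
    by (simp add: price_marginal_def pmf_map)
  also have "\<dots> = measure \<sigma> ((snd -` {p}) \<inter> set_pmf \<sigma>)"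
    by (simp add: measure_Int_set_pmf)
  also have "(snd -` {p}) \<inter> set_pmf \<sigma> = (\<Theta> \<times> {p}) \<inter> set_pmf \<sigma>"
    using assms(2) by (auto simp: Delta_def)
  also have "measure \<sigma> \<dots> = measure \<sigma> (\<Theta> \<times> {p})"
    by (simp add: measure_Int_set_pmf)
  also have "\<dots> = (\<Sum>x\<in>\<Theta> \<times> {p}. pmf \<sigma> x)"
    using assms(1) by (simp add: measure_measure_pmf_finite)
  also have "\<dots> = (\<Sum>\<theta>\<in>\<Theta>. pmf \<sigma> (\<theta>, p))"
    by (simp add: sum.cartesian_product')
  finally show ?thesis .
qed

lemma pmf_type_cond:
  assumes "p \<in> set_pmf (price_marginal \<sigma>)"
  shows "pmf (type_cond \<sigma> p) \<theta> = pmf \<sigma> (\<theta>, p) / pmf (price_marginal \<sigma>) p"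
proof -
  have ne: "set_pmf \<sigma> \<inter> UNIV \<times> {p} \<noteq> {}"
    using assms by (force simp: price_marginal_def)
  have inj: "inj_on fst (set_pmf (cond_pmf \<sigma> (UNIV \<times> {p})))"
    using ne by (auto simp: set_cond_pmf inj_on_def)
  have snd: "(snd -` {p} :: (real \<times> real) set) = UNIV \<times> {p}"
    by auto
  have "pmf (type_cond \<sigma> p) \<theta> = measure (cond_pmf \<sigma> (UNIV \<times> {p})) (fst -` {\<theta>})"
    by (simp add: type_cond_def pmf_map)
  also have "\<dots> = measure (cond_pmf \<sigma> (UNIV \<times> {p}))
      ((fst -` {\<theta>}) \<inter> set_pmf (cond_pmf \<sigma> (UNIV \<times> {p})))"
    by (simp add: measure_Int_set_pmf)
  also have "(fst -` {\<theta>}) \<inter> set_pmf (cond_pmf \<sigma> (UNIV \<times> {p})) =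
      {(\<theta>, p)} \<inter> set_pmf (cond_pmf \<sigma> (UNIV \<times> {p}))"
    using ne by (auto simp: set_cond_pmf)
  also have "measure (cond_pmf \<sigma> (UNIV \<times> {p})) \<dots> = pmf (cond_pmf \<sigma> (UNIV \<times> {p})) (\<theta>, p)"
    by (simp add: measure_Int_set_pmf measure_pmf_single)
  also have "\<dots> = pmf \<sigma> (\<theta>, p) / pmf (price_marginal \<sigma>) p"
    using ne by (simp add: pmf_cond price_marginal_def pmf_map snd)
  finally show ?thesis .
qed

definition strictly_redistributive :: "real set \<Rightarrow> (real \<Rightarrow> real \<Rightarrow> real) \<Rightarrow> bool" where
  "strictly_redistributive \<Theta> w \<longleftrightarrow>
     (\<forall>\<theta>\<in>\<Theta>. \<forall>p\<in>\<Theta>. (\<theta> < p \<longrightarrow> w \<theta> p = 0) \<and> (\<theta> \<ge> p \<longrightarrow> w \<theta> p \<ge> 0)) \<and>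
     (\<forall>\<theta>\<in>\<Theta>. strict_antimono_on {p\<in>\<Theta>. p \<le> \<theta>} (w \<theta>)) \<and>
     (\<forall>\<theta>\<in>\<Theta>. \<forall>\<theta>'\<in>\<Theta>. \<forall>p\<in>\<Theta>. \<forall>p'\<in>\<Theta>.
        \<theta>' > \<theta> \<and> \<theta> \<ge> p' \<and> p' > p \<longrightarrow> w \<theta> p - w \<theta> p' > w \<theta>' p - w \<theta>' p')"

definition welfare ::
    "real set \<Rightarrow> (real \<Rightarrow> real \<Rightarrow> real) \<Rightarrow> (real \<times> real) pmf \<Rightarrow> real" where
  "welfare \<Theta> w \<sigma> = (\<Sum>(\<theta>, p)\<in>\<Theta> \<times> \<Theta>. w \<theta> p * pmf \<sigma> (\<theta>, p))"

definition optimal ::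
    "real set \<Rightarrow> (real \<Rightarrow> real \<Rightarrow> real) \<Rightarrow> real pmf \<Rightarrow> (real \<times> real) pmf \<Rightarrow> bool" where
  "optimal \<Theta> w \<mu> \<sigma> \<longleftrightarrow>
     \<sigma> \<in> segmentations_star \<Theta> \<mu> \<and>
     (\<forall>\<tau>\<in>segmentations_star \<Theta> \<mu>. welfare \<Theta> w \<tau> \<le> welfare \<Theta> w \<sigma>)"

definition weakly_monotone :: "(real \<times> real) pmf \<Rightarrow> bool" where
  "weakly_monotone \<sigma> \<longleftrightarrow>
     (\<forall>p\<in>set_pmf (price_marginal \<sigma>). \<forall>p'\<in>set_pmf (price_marginal \<sigma>). p < p' \<longrightarrow>
        Max (set_pmf (type_cond \<sigma> p)) \<le> Max (set_pmf (type_cond \<sigma> p')))"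

end

theory Submission
  imports Defs
begin

text \<open>
  Suppose the highest type \<open>M\<close> buying at price \<open>p\<close> exceeds the highest type \<open>M'\<close> buying at a
  price \<open>p' > p\<close>. Exchange a small mass \<open>\<epsilon>\<close> of the types \<open>M\<close> and \<open>M'\<close> between the two
  segments. As \<open>p < p' \<le> M' < M\<close>, strict redistributivity makes this a strict improvement.
  The revenue of the recommended prices does not change. In segment \<open>p\<close> all other prices become
  weakly less attractive; in segment \<open>p'\<close> only prices in \<open>(M', M]\<close> become more attractive, and
  they earned nothing before the exchange, so for small \<open>\<epsilon>\<close> obedience is preserved.
\<close>

lemma ex_pmf_finite_support:
  fixes f :: "'a \<Rightarrow> real"
  assumes "finite A" "\<And>x. 0 \<le> f x" "\<And>x. x \<notin> A \<Longrightarrow> f x = 0" "sum f A = 1"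
  shows "\<exists>\<pi>. pmf \<pi> = f"
proof
  have "(\<integral>\<^sup>+x. ennreal (f x) \<partial>count_space UNIV) = (\<Sum>x\<in>A. ennreal (f x))"
    using assms by (intro nn_integral_count_space') auto
  also have "\<dots> = 1"
    using assms by (simp add: sum_ennreal)
  finally show "pmf (embed_pmf f) = f"
    using assms(2) by (auto simp: pmf_embed_pmf)
qed

lemma set_pmf_type_cond:
  assumes "p \<in> set_pmf (price_marginal \<sigma>)"
  shows "set_pmf (type_cond \<sigma> p) = {\<theta>. (\<theta>, p) \<in> set_pmf \<sigma>}"
  using assms by (auto simp: set_pmf_iff pmf_type_cond)

text \<open>The signed measure that moves a unit of mass from \<open>y\<close> to \<open>x\<close>.
  A product of two of these, one in the type and one in the price, has both marginals zero, so
  adding it to a segmentation leaves both marginals unchanged.\<close>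

definition exchange :: "'a \<Rightarrow> 'a \<Rightarrow> 'a \<Rightarrow> real" where
  "exchange x y z = of_bool (z = x) - of_bool (z = y)"

lemma sum_exchange:
  assumes "finite A"
  shows "(\<Sum>z\<in>A. exchange x y z) = of_bool (x \<in> A) - of_bool (y \<in> A)"
  using assms by (simp add: exchange_def sum_subtractf of_bool_def)

lemma sum_mult_exchange:
  assumes "finite A" "x \<in> A" "y \<in> A"
  shows "(\<Sum>z\<in>A. g z * exchange x y z) = g x - g y"
  using assms by (simp add: exchange_def right_diff_distrib sum_subtractf of_bool_def
      if_distrib[of "(*) _"] cong: if_cong)

lemma improving_exchange:
  assumes fin: "finite \<Theta>" and nonneg: "\<And>\<theta>. \<theta> \<in> \<Theta> \<Longrightarrow> \<theta> \<ge> 0"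
    and w: "strictly_redistributive \<Theta> w"
    and \<sigma>: "\<sigma> \<in> segmentations_star \<Theta> \<mu>"
    and M: "(M, p) \<in> set_pmf \<sigma>" and M': "(M', p') \<in> set_pmf \<sigma>"
    and max: "\<And>\<theta>. (\<theta>, p') \<in> set_pmf \<sigma> \<Longrightarrow> \<theta> \<le> M'"
    and less: "p < p'" "M' < M"
  shows "\<exists>\<tau>\<in>segmentations_star \<Theta> \<mu>. welfare \<Theta> w \<sigma> < welfare \<Theta> w \<tau>"
proof -
  have supp: "set_pmf \<sigma> \<subseteq> Omega \<Theta>" and ob: "obedient \<Theta> \<sigma>"
    and marg: "\<And>\<theta>. \<theta> \<in> \<Theta> \<Longrightarrow> (\<Sum>r\<in>\<Theta>. pmf \<sigma> (\<theta>, r)) = pmf \<mu> \<theta>"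
    using \<sigma> by (auto simp: segmentations_star_def segmentations_def)
  have mem: "M \<in> \<Theta>" "M' \<in> \<Theta>" "p \<in> \<Theta>" "p' \<in> \<Theta>" and p'M': "p' \<le> M'"
    using M M' supp by (auto simp: Omega_def)
  \<comment> \<open>\<open>T q r\<close> is the demand at price \<open>q\<close> in segment
    \<open>r\<close>, so obedience compares the revenues \<open>q * T q r\<close> and
    \<open>r * T r r\<close>.\<close>
  define T where "T q r = (\<Sum>\<theta>\<in>{\<theta>\<in>\<Theta>. \<theta> \<ge> q}. pmf \<sigma> (\<theta>, r))" for q r
  have T0: "0 \<le> T q r" for q r
    by (simp add: T_def sum_nonneg)
  have Tob: "q * T q r \<le> r * T r r" if "q \<in> \<Theta>" "r \<in> \<Theta>" for q r
    using ob that by (auto simp: obedient_def T_def)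
  have p'0: "0 < p'"
    using less nonneg[OF mem(3)] by simp
  have M0: "0 < M"
    using p'0 p'M' less by simp
  have "pmf \<sigma> (M', p') \<le> T p' p'"
    unfolding T_def using fin mem p'M' by (intro member_le_sum) auto
  then have Tpos: "0 < T p' p'"
    using pmf_positive[OF M'] by simp
  \<comment> \<open>The first two bounds keep the two reduced masses nonnegative. The third ensures
    that selling to a mass \<epsilon> at any price up to \<open>M\<close> earns no more than
    \<open>p'\<close> does in segment \<open>p'\<close>.\<close>
  define \<epsilon> where "\<epsilon> = min (min (pmf \<sigma> (M, p)) (pmf \<sigma> (M', p'))) (p' * T p' p' / M)"
  have \<epsilon>: "0 < \<epsilon>" "\<epsilon> \<le> pmf \<sigma> (M, p)" "\<epsilon> \<le> pmf \<sigma> (M', p')" "M * \<epsilon> \<le> p' * T p' p'"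
  proof -
    show "0 < \<epsilon>"
      using M M' M0 p'0 Tpos by (simp add: \<epsilon>_def pmf_positive)
    show "\<epsilon> \<le> pmf \<sigma> (M, p)" "\<epsilon> \<le> pmf \<sigma> (M', p')"
      by (simp_all add: \<epsilon>_def)
    have "\<epsilon> \<le> p' * T p' p' / M"
      by (simp add: \<epsilon>_def)
    then show "M * \<epsilon> \<le> p' * T p' p'"
      using M0 by (simp add: field_simps)
  qed
  \<comment> \<open>Mass \<epsilon> leaves \<open>(M, p)\<close> and \<open>(M', p')\<close> and
    arrives at \<open>(M', p)\<close> and \<open>(M, p')\<close>. All four cells lie in
    \<open>Omega \<Theta>\<close> because \<open>p < p' \<le> M' < M\<close>.\<close>
  define f where "f x = pmf \<sigma> x + \<epsilon> * (exchange M' M (fst x) * exchange p p' (snd x))" for x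
  have out: "f x = 0" if "x \<notin> Omega \<Theta>" for x
  proof -
    have "x \<notin> {(M, p), (M', p'), (M, p'), (M', p)}"
      using that mem p'M' less by (auto simp: Omega_def)
    moreover have "pmf \<sigma> x = 0"
      using that supp by (auto simp: set_pmf_iff)
    ultimately show ?thesis
      by (cases x) (auto simp: f_def exchange_def)
  qed
  have f0: "0 \<le> f x" for x
    using \<epsilon> less by (cases x) (auto simp: f_def exchange_def)
  have fmarg: "(\<Sum>r\<in>\<Theta>. f (\<theta>, r)) = (\<Sum>r\<in>\<Theta>. pmf \<sigma> (\<theta>, r))" for \<theta>
    using fin mem by (simp add: f_def sum.distrib sum_exchange flip: sum_distrib_left)
  have "sum f (\<Theta> \<times> \<Theta>) = (\<Sum>\<theta>\<in>\<Theta>. \<Sum>r\<in>\<Theta>. f (\<theta>, r))"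
    by (simp add: sum.cartesian_product')
  also have "\<dots> = sum (pmf \<sigma>) (\<Theta> \<times> \<Theta>)"
    by (simp add: fmarg sum.cartesian_product')
  also have "\<dots> = 1"
    using supp fin by (intro sum_pmf_eq_1) (auto simp: Omega_def)
  finally have "sum f (\<Theta> \<times> \<Theta>) = 1" .
  moreover have "f x = 0" if "x \<notin> \<Theta> \<times> \<Theta>" for x
    using that by (intro out) (auto simp: Omega_def)
  ultimately obtain \<tau> where \<tau>: "pmf \<tau> = f"
    using ex_pmf_finite_support[of "\<Theta> \<times> \<Theta>" f] fin f0 by blast
  have \<tau>supp: "set_pmf \<tau> \<subseteq> Omega \<Theta>"
    unfolding set_pmf_eq \<tau> using out by blast
  \<comment> \<open>The difference of indicators is -1 for \<open>M' < q \<le> M\<close> and 0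
    otherwise: at other prices either both exchanged types buy or neither does.\<close>
  have tail: "(\<Sum>\<theta>\<in>{\<theta>\<in>\<Theta>. \<theta> \<ge> q}. f (\<theta>, r)) =
      T q r + \<epsilon> * (exchange p p' r * (of_bool (q \<le> M') - of_bool (q \<le> M)))" for q r
    using fin mem
    by (simp add: f_def T_def sum.distrib sum_exchange flip: sum_distrib_left sum_distrib_right)
  have "obedient \<Theta> \<tau>"
    unfolding obedient_def \<tau> tail
  proof (intro ballI)
    fix r q assume rq: "r \<in> \<Theta>" "q \<in> \<Theta>"
    \<comment> \<open>Only \<open>r = p\<close> and \<open>r = p'\<close> matter, and both prices
      are at most \<open>M'\<close>, so both exchanged types still buy.\<close>
    have own: "exchange p p' r * (of_bool (r \<le> M') - of_bool (r \<le> M)) = 0"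
      using less p'M' by (auto simp: exchange_def)
    consider "exchange p p' r * (of_bool (q \<le> M') - of_bool (q \<le> M)) \<le> 0"
      | "r = p'" "M' < q" "q \<le> M"
      using less by (cases "r = p'"; cases "q \<le> M'"; cases "q \<le> M") (auto simp: exchange_def)
    then have "q * (T q r + \<epsilon> * (exchange p p' r * (of_bool (q \<le> M') - of_bool (q \<le> M))))
        \<le> r * T r r"
    proof cases
      case 1
      then have "q * (T q r + \<epsilon> * (exchange p p' r * (of_bool (q \<le> M') - of_bool (q \<le> M))))
          \<le> q * T q r"
        using nonneg[OF rq(2)] \<epsilon>(1)
        by (intro mult_left_mono) (auto simp: mult_le_0_iff)
      then show ?thesis
        using Tob[OF rq(2,1)] by simp
    next
      case 2
      \<comment> \<open>Before the exchange, no type in segment \<open>p'\<close> exceeds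
        \<open>M'\<close>, so demand at \<open>q\<close> is now exactly \<epsilon>.\<close>
      have "T q r = 0"
        unfolding T_def using 2 max by (intro sum.neutral) (force simp: set_pmf_iff)
      moreover have "q * \<epsilon> \<le> M * \<epsilon>"
        using 2 \<epsilon>(1) by simp
      ultimately show ?thesis
        using 2 \<epsilon>(4) less by (simp add: exchange_def)
    qed
    then show "r * (T r r + \<epsilon> * (exchange p p' r * (of_bool (r \<le> M') - of_bool (r \<le> M))))
        \<ge> q * (T q r + \<epsilon> * (exchange p p' r * (of_bool (q \<le> M') - of_bool (q \<le> M))))"
      unfolding own by simp
  qed
  then have "\<tau> \<in> segmentations_star \<Theta> \<mu>"
    using \<tau>supp marg fmarg
    by (auto simp: segmentations_star_def segmentations_def Delta_def Omega_def \<tau>)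
  moreover have "welfare \<Theta> w \<sigma> < welfare \<Theta> w \<tau>"
  proof -
    \<comment> \<open>Welfare is linear, so its change is \<epsilon> times a mixed difference of
      \<open>w\<close>. This is positive by the third clause of
      \<open>strictly_redistributive\<close>, applied to the types \<open>M' < M\<close> and the
      prices \<open>p < p'\<close>.\<close>
    have "welfare \<Theta> w \<tau> = welfare \<Theta> w \<sigma> +
        \<epsilon> * (\<Sum>\<theta>\<in>\<Theta>. (\<Sum>r\<in>\<Theta>. w \<theta> r * exchange p p' r) * exchange M' M \<theta>)"
      by (simp add: welfare_def \<tau> f_def sum.cartesian_product' sum.distrib sum_distrib_left
          sum_distrib_right algebra_simps)
    also have "\<dots> = welfare \<Theta> w \<sigma> + \<epsilon> * ((w M' p - w M' p') - (w M p - w M p'))"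
      using fin mem by (simp add: sum_mult_exchange)
    finally show ?thesis
      using w mem p'M' less \<epsilon>(1) by (simp add: strictly_redistributive_def)
  qed
  ultimately show ?thesis
    by blast
qed

theorem corollary1:
  fixes \<Theta> :: "real set" and \<mu> :: "real pmf" and w :: "real \<Rightarrow> real \<Rightarrow> real"
    and \<sigma> :: "(real \<times> real) pmf"
  assumes "finite \<Theta>" and "\<And>\<theta>. \<theta> \<in> \<Theta> \<Longrightarrow> \<theta> \<ge> 0"
    and "\<mu> \<in> Delta \<Theta>" and "\<And>\<theta>. \<theta> \<in> \<Theta> \<Longrightarrow> pmf \<mu> \<theta> > 0"
    and "strictly_redistributive \<Theta> w"
    and "optimal \<Theta> w \<mu> \<sigma>"
  shows "weakly_monotone \<sigma>"
  unfolding weakly_monotone_def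
proof (intro ballI impI)
  fix p p'
  assume p: "p \<in> set_pmf (price_marginal \<sigma>)" and p': "p' \<in> set_pmf (price_marginal \<sigma>)"
    and "p < p'"
  have star: "\<sigma> \<in> segmentations_star \<Theta> \<mu>"
    using assms(6) by (simp add: optimal_def)
  have fin: "finite {\<theta>. (\<theta>, r) \<in> set_pmf \<sigma>}" for r
    by (rule finite_subset[OF _ assms(1)])
      (use star in \<open>auto simp: segmentations_star_def Omega_def\<close>)
  have ne: "{\<theta>. (\<theta>, p) \<in> set_pmf \<sigma>} \<noteq> {}" "{\<theta>. (\<theta>, p') \<in> set_pmf \<sigma>} \<noteq> {}"
    using p p' by (auto simp: price_marginal_def)
  define M M' where "M = Max {\<theta>. (\<theta>, p) \<in> set_pmf \<sigma>}" and "M' = Max {\<theta>. (\<theta>, p') \<in> set_pmf \<sigma>}"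
  have M: "(M, p) \<in> set_pmf \<sigma>" and M': "(M', p') \<in> set_pmf \<sigma>"
    using Max_in[OF fin ne(1)] Max_in[OF fin ne(2)] by (simp_all add: M_def M'_def)
  have "\<theta> \<le> M'" if "(\<theta>, p') \<in> set_pmf \<sigma>" for \<theta>
    using Max_ge[OF fin] that by (simp add: M'_def)
  \<comment> \<open>If \<open>M' < M\<close>, the exchange would give a feasible segmentation with
    higher welfare, against optimality.\<close>
  from improving_exchange[OF assms(1,2,5) star M M' this \<open>p < p'\<close>] have "\<not> M' < M"
    using assms(6) by (force simp: optimal_def not_less[symmetric])
  then show "Max (set_pmf (type_cond \<sigma> p)) \<le> Max (set_pmf (type_cond \<sigma> p'))"
    using p p' by (simp add: set_pmf_type_cond M_def M'_def)
qed

end
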